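(* Let $(A,\{\cdot,\cdot\},\mu,\alpha,\beta)$ be a BiHom-Poisson algebra and let $V_{\phi,\psi}=(V,\phi,\psi)$ be a left BiHom-Poisson $A$-module with structure maps $\lambda$ and $\rho$. Then for each $n,m\in\mathbb{N}$, the maps $$\lambda^{(n,m)}=\lambda\circ(\alpha^n\beta^m\otimes Id_V),\qquad \rho^{(n,m)}=\rho\circ(\alpha^n\beta^m\otimes Id_V)$$ give the BiHom-module $(V,\phi,\psi)$ the structure of a left BiHom-Poisson $A$-module (denoted $V_{\phi,\psi}^{(n,m)}$).
   Context: All vector spaces are over an algebraically closed field $\mathbb{K}$ of characteristic $0$. A BiHom-Poisson algebra is a tuple $(A,\{\cdot,\cdot\},\mu,\alpha,\beta)$ with $A$ a vector space, $\mu,\{\cdot,\cdot\}:A\times A\to A$ bilinear and $\alpha,\beta:A\to A$ linear with $\alpha\beta=\beta\alpha$, such that for all $x,y,z\in A$: (i) $\alpha$ and $\beta$ are multiplicative for both products, i.e. $\gamma(\mu(x,y))=\mu(\gamma(x),\gamma(y))$ and $\gamma(\{x,y\})=\{\gamma(x),\gamma(y)\}$ for $\gamma\in\{\alpha,\beta\}$; (ii) BiHom-commutativity: $\mu(\beta(x),\alpha(y))=\mu(\beta(y),\alpha(x))$; (iii) BiHom-associativity: $\mu(\mu(x,y),\beta(z))=\mu(\alpha(x),\mu(y,z))$; (iv) BiHom-skew-symmetry: $\{\beta(x),\alpha(y)\}=-\{\beta(y),\alpha(x)\}$; (v) BiHom-Jacobi identity: $\{\beta^2(x),\{\beta(y),\alpha(z)\}\}+\{\beta^2(y),\{\beta(z),\alpha(x)\}\}+\{\beta^2(z),\{\beta(x),\alpha(y)\}\}=0$;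 (vi) BiHom-Leibniz identity: $\{\alpha\beta(x),\mu(y,z)\}=\mu(\{\beta(x),y\},\beta(z))+\mu(\beta(y),\{\alpha(x),z\})$. A BiHom-module is $(V,\phi,\psi)$ with $V$ a vector space and $\phi,\psi:V\to V$ commuting linear maps. A left BiHom-Poisson $A$-module is a BiHom-module $(V,\phi,\psi)$ with structure maps, i.e. bilinear maps $\lambda,\rho:A\times V\to V$ that are morphisms of BiHom-modules ($\phi(\lambda(x,v))=\lambda(\alpha(x),\phi(v))$, $\psi(\lambda(x,v))=\lambda(\beta(x),\psi(v))$, and likewise for $\rho$), such that for all $x,y\in A$, $v\in V$: $\lambda(\alpha(x),\lambda(y,v))=\lambda(\mu(x,y),\psi(v))$; $\rho(\{\beta(x),y\},\psi(v))=\rho(\alpha\beta(x),\rho(y,v))-\rho(\beta(y),\rho(\alpha(x),v))$; $\rho(\alpha\beta(x),\lambda(y,v))=\lambda(\{\beta(x),y\},\psi(v))+\lambda(\beta(y),\rho(\alpha(x),v))$; $\rho(\mu(\beta(x),y),\psi(v))=\lambda(\alpha\beta(x),\rho(y,v))+\lambda(\beta(y),\rho(\alpha(x),v))$. *)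

theory Defs
  imports Complex_Main "HOL-Computational_Algebra.Polynomial"
begin

definition bilinear_map ::
  "('k::field \<Rightarrow> 'a::ab_group_add \<Rightarrow> 'a) \<Rightarrow> ('k \<Rightarrow> 'b::ab_group_add \<Rightarrow> 'b) \<Rightarrow>
   ('k \<Rightarrow> 'c::ab_group_add \<Rightarrow> 'c) \<Rightarrow> ('a \<Rightarrow> 'b \<Rightarrow> 'c) \<Rightarrow> bool" where
  "bilinear_map sA sB sC f \<longleftrightarrow>
     (\<forall>x. Vector_Spaces.linear sB sC (f x)) \<and>
     (\<forall>y. Vector_Spaces.linear sA sC (\<lambda>x. f x y))"

locale bihom_module =
  vector_space scale
  for scale :: "'k::{alg_closed_field,field_char_0} \<Rightarrow> 'v::ab_group_add \<Rightarrow> 'v" +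
  fixes \<phi> \<psi> :: "'v \<Rightarrow> 'v"
  assumes linear_fst: "Vector_Spaces.linear scale scale \<phi>"
    and linear_snd: "Vector_Spaces.linear scale scale \<psi>"
    and commute: "\<phi> (\<psi> v) = \<psi> (\<phi> v)"

text \<open>The bracket \<open>{x, y}\<close> is written \<open>brk x y\<close>.\<close>

locale bihom_poisson_algebra =
  bihom_module scaleA \<alpha> \<beta>
  for scaleA :: "'k::{alg_closed_field,field_char_0} \<Rightarrow> 'a::ab_group_add \<Rightarrow> 'a"
    and brk :: "'a \<Rightarrow> 'a \<Rightarrow> 'a"
    and \<mu> :: "'a \<Rightarrow> 'a \<Rightarrow> 'a"
    and \<alpha> \<beta> :: "'a \<Rightarrow> 'a" +
  assumes bilinear_mu: "bilinear_map scaleA scaleA scaleA \<mu>"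
    and bilinear_brk: "bilinear_map scaleA scaleA scaleA brk"
    and alpha_mu: "\<alpha> (\<mu> x y) = \<mu> (\<alpha> x) (\<alpha> y)"
    and beta_mu: "\<beta> (\<mu> x y) = \<mu> (\<beta> x) (\<beta> y)"
    and alpha_brk: "\<alpha> (brk x y) = brk (\<alpha> x) (\<alpha> y)"
    and beta_brk: "\<beta> (brk x y) = brk (\<beta> x) (\<beta> y)"
    and bihom_commutative: "\<mu> (\<beta> x) (\<alpha> y) = \<mu> (\<beta> y) (\<alpha> x)"
    and bihom_associative: "\<mu> (\<mu> x y) (\<beta> z) = \<mu> (\<alpha> x) (\<mu> y z)"
    and bihom_skew_symmetric: "brk (\<beta> x) (\<alpha> y) = - brk (\<beta> y) (\<alpha> x)"
    and bihom_jacobi: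
      "brk (\<beta> (\<beta> x)) (brk (\<beta> y) (\<alpha> z))
       + brk (\<beta> (\<beta> y)) (brk (\<beta> z) (\<alpha> x))
       + brk (\<beta> (\<beta> z)) (brk (\<beta> x) (\<alpha> y)) = 0"
    and bihom_leibniz:
      "brk (\<alpha> (\<beta> x)) (\<mu> y z)
       = \<mu> (brk (\<beta> x) y) (\<beta> z) + \<mu> (\<beta> y) (brk (\<alpha> x) z)"

text \<open>
  The structure maps \<open>\<lambda>\<close> and \<open>\<rho>\<close> are written \<open>lam\<close> and \<open>rho\<close>.
  The \<open>phi\<close> and \<open>psi\<close> assumptions say that they are morphisms of BiHom-modules,
  \<open>A \<otimes> V\<close> carrying the maps \<open>\<alpha> \<otimes> \<phi>\<close> and \<open>\<beta> \<otimes> \<psi>\<close>.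
\<close>

locale left_bihom_poisson_module =
  A: bihom_poisson_algebra scaleA brk \<mu> \<alpha> \<beta> +
  V: bihom_module scaleV \<phi> \<psi>
  for scaleA :: "'k::{alg_closed_field,field_char_0} \<Rightarrow> 'a::ab_group_add \<Rightarrow> 'a"
    and brk \<mu> :: "'a \<Rightarrow> 'a \<Rightarrow> 'a"
    and \<alpha> \<beta> :: "'a \<Rightarrow> 'a"
    and scaleV :: "'k \<Rightarrow> 'v::ab_group_add \<Rightarrow> 'v"
    and \<phi> \<psi> :: "'v \<Rightarrow> 'v" +
  fixes lam rho :: "'a \<Rightarrow> 'v \<Rightarrow> 'v"
  assumes bilinear_lam: "bilinear_map scaleA scaleV scaleV lam"
    and bilinear_rho: "bilinear_map scaleA scaleV scaleV rho"
    and phi_lam: "\<phi> (lam x v) = lam (\<alpha> x) (\<phi> v)"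
    and psi_lam: "\<psi> (lam x v) = lam (\<beta> x) (\<psi> v)"
    and phi_rho: "\<phi> (rho x v) = rho (\<alpha> x) (\<phi> v)"
    and psi_rho: "\<psi> (rho x v) = rho (\<beta> x) (\<psi> v)"
    and lam_lam: "lam (\<alpha> x) (lam y v) = lam (\<mu> x y) (\<psi> v)"
    and rho_brk:
      "rho (brk (\<beta> x) y) (\<psi> v)
       = rho (\<alpha> (\<beta> x)) (rho y v) - rho (\<beta> y) (rho (\<alpha> x) v)"
    and rho_lam:
      "rho (\<alpha> (\<beta> x)) (lam y v)
       = lam (brk (\<beta> x) y) (\<psi> v) + lam (\<beta> y) (rho (\<alpha> x) v)"
    and rho_mu:
      "rho (\<mu> (\<beta> x) y) (\<psi> v)
       = lam (\<alpha> (\<beta> x)) (rho y v) + lam (\<beta> y) (rho (\<alpha> x) v)"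

text \<open>\<open>f \<circ> (\<alpha>\<^sup>n \<beta>\<^sup>m \<otimes> Id)\<close>, for a map \<open>f\<close> on \<open>A \<times> V\<close> in curried form.\<close>

definition twist ::
  "('a \<Rightarrow> 'a) \<Rightarrow> ('a \<Rightarrow> 'a) \<Rightarrow> nat \<Rightarrow> nat \<Rightarrow> ('a \<Rightarrow> 'v \<Rightarrow> 'v) \<Rightarrow> 'a \<Rightarrow> 'v \<Rightarrow> 'v" where
  "twist \<alpha> \<beta> n m f = (\<lambda>x v. f (((\<alpha> ^^ n) \<circ> (\<beta> ^^ m)) x) v)"

end

theory Submission
  imports Defs
begin

text \<open>
  The map \<open>\<alpha>\<^sup>n \<beta>\<^sup>m\<close> is an endomorphism of the BiHom-Poisson algebra \<open>A\<close>: it is linear,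
  multiplicative for both products, and commutes with \<open>\<alpha>\<close> and \<open>\<beta>\<close>. Restriction of scalars along
  such an endomorphism \<open>g\<close> turns \<open>A\<close>-modules into \<open>A\<close>-modules
  (\<open>pullback_along_endomorphism\<close>): in each module identity for \<open>lam (g x) v\<close> and \<open>rho (g x) v\<close>,
  moving \<open>g\<close> inwards past \<open>\<alpha>\<close>, \<open>\<beta>\<close>, the product and the bracket leaves the original identity
  with \<open>g\<close> applied to each algebra variable.

  Since pulling back along \<open>g\<close> and then along \<open>h\<close> is pulling back along \<open>g \<circ> h\<close>, it is
  enough to know this for \<open>g = \<alpha>\<close> and \<open>g = \<beta>\<close> and to repeat it \<open>n\<close> and \<open>m\<close> times.
\<close>

lemma bilinear_map_compose_left:
  assumes f: "bilinear_map sA sB sC f" and g: "Vector_Spaces.linear sA sA g"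
  shows "bilinear_map sA sB sC (\<lambda>x. f (g x))"
proof -
  have "Vector_Spaces.linear sA sC (\<lambda>x. f (g x) y)" for y
    using Vector_Spaces.linear_compose[OF g, of sC "\<lambda>x. f x y"] f
    by (simp add: bilinear_map_def comp_def)
  with f show ?thesis by (simp add: bilinear_map_def)
qed

text \<open>
  Only bilinearity needs more than rewriting: it rests on the linearity of \<open>g\<close>. Every identity
  of the new module is, after moving \<open>g\<close> inwards, an instance of the same identity of the old one.
\<close>

lemma pullback_along_endomorphism:
  assumes module: "left_bihom_poisson_module scaleA brk \<mu> \<alpha> \<beta> scaleV \<phi> \<psi> lam rho"
    and linear: "Vector_Spaces.linear scaleA scaleA g"
    and mult: "\<And>x y. g (\<mu> x y) = \<mu> (g x) (g y)" "\<And>x y. g (brk x y) = brk (g x) (g y)"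
    and comm: "\<And>x. g (\<alpha> x) = \<alpha> (g x)" "\<And>x. g (\<beta> x) = \<beta> (g x)"
  shows "left_bihom_poisson_module scaleA brk \<mu> \<alpha> \<beta> scaleV \<phi> \<psi>
           (\<lambda>x. lam (g x)) (\<lambda>x. rho (g x))"
proof -
  interpret M: left_bihom_poisson_module scaleA brk \<mu> \<alpha> \<beta> scaleV \<phi> \<psi> lam rho
    by (fact module)
  show ?thesis
  proof
    show "bilinear_map scaleA scaleV scaleV (\<lambda>x. lam (g x))"
      by (rule bilinear_map_compose_left[OF M.bilinear_lam linear])
    show "bilinear_map scaleA scaleV scaleV (\<lambda>x. rho (g x))"
      by (rule bilinear_map_compose_left[OF M.bilinear_rho linear])
  qed (simp_all only: mult comm M.phi_lam M.psi_lam M.phi_rho M.psi_rho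
        M.lam_lam M.rho_brk M.rho_lam M.rho_mu)
qed

lemma pullback_along_endomorphism_power:
  assumes "left_bihom_poisson_module scaleA brk \<mu> \<alpha> \<beta> scaleV \<phi> \<psi> lam rho"
    and "Vector_Spaces.linear scaleA scaleA g"
    and "\<And>x y. g (\<mu> x y) = \<mu> (g x) (g y)" "\<And>x y. g (brk x y) = brk (g x) (g y)"
    and "\<And>x. g (\<alpha> x) = \<alpha> (g x)" "\<And>x. g (\<beta> x) = \<beta> (g x)"
  shows "left_bihom_poisson_module scaleA brk \<mu> \<alpha> \<beta> scaleV \<phi> \<psi>
           (\<lambda>x. lam ((g ^^ n) x)) (\<lambda>x. rho ((g ^^ n) x))"
proof (induction n)
  case 0
  show ?case using assms(1) by simp
next
  case (Suc n)
  \<comment> \<open>The extra factor of \<open>g\<close> must be applied first, since pulling back precomposes with it.\<close>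
  have "left_bihom_poisson_module scaleA brk \<mu> \<alpha> \<beta> scaleV \<phi> \<psi>
          (\<lambda>x. lam ((g ^^ n) (g x))) (\<lambda>x. rho ((g ^^ n) (g x)))"
    by (rule pullback_along_endomorphism[where g = g, OF Suc.IH]) (fact assms)+
  then show ?case by (simp add: funpow_Suc_right del: funpow.simps)
qed

theorem proposition5p11:
  fixes scaleA :: "'k::{alg_closed_field,field_char_0} \<Rightarrow> 'a::ab_group_add \<Rightarrow> 'a"
    and brk \<mu> :: "'a \<Rightarrow> 'a \<Rightarrow> 'a"
    and \<alpha> \<beta> :: "'a \<Rightarrow> 'a"
    and scaleV :: "'k \<Rightarrow> 'v::ab_group_add \<Rightarrow> 'v"
    and \<phi> \<psi> :: "'v \<Rightarrow> 'v"
    and lam rho :: "'a \<Rightarrow> 'v \<Rightarrow> 'v"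
    and n m :: nat
  assumes "bihom_poisson_algebra scaleA brk \<mu> \<alpha> \<beta>"
    and "left_bihom_poisson_module scaleA brk \<mu> \<alpha> \<beta> scaleV \<phi> \<psi> lam rho"
  shows "left_bihom_poisson_module scaleA brk \<mu> \<alpha> \<beta> scaleV \<phi> \<psi>
           (twist \<alpha> \<beta> n m lam) (twist \<alpha> \<beta> n m rho)"
proof -
  interpret A: bihom_poisson_algebra scaleA brk \<mu> \<alpha> \<beta> by (fact assms(1))
  have "left_bihom_poisson_module scaleA brk \<mu> \<alpha> \<beta> scaleV \<phi> \<psi>
          (\<lambda>x. lam ((\<alpha> ^^ n) x)) (\<lambda>x. rho ((\<alpha> ^^ n) x))"
    by (rule pullback_along_endomorphism_power[where g = \<alpha>, OF assms(2) A.linear_fst])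
      (simp_all only: A.alpha_mu A.alpha_brk A.commute)
  then have "left_bihom_poisson_module scaleA brk \<mu> \<alpha> \<beta> scaleV \<phi> \<psi>
          (\<lambda>x. lam ((\<alpha> ^^ n) ((\<beta> ^^ m) x))) (\<lambda>x. rho ((\<alpha> ^^ n) ((\<beta> ^^ m) x)))"
    by (rule pullback_along_endomorphism_power[where g = \<beta>, OF _ A.linear_snd])
      (simp_all only: A.beta_mu A.beta_brk A.commute)
  then show ?thesis by (simp add: twist_def)
qed

end
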